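(* Let $D$ be an Egyptian domain. Let $W$ be a multiplicative subset of the polynomial ring $D[X]$ with $0 \notin W$ such that $W \nsubseteq D$. Then the localization $R = D[X]_W = W^{-1}D[X]$ is Egyptian.
   Context: An element of the fraction field of an integral domain $D$ is called Egyptian (with respect to $D$) if it can be written as a finite sum $\frac{1}{d_1}+\cdots+\frac{1}{d_n}$ with $d_1,\ldots,d_n$ distinct nonzero elements of $D$. An integral domain $D$ is called Egyptian if every nonzero element of $D$ is Egyptian. The ring $D$ is regarded as the subring of constant polynomials of $D[X]$. All rings are commutative with identity. *)

theory Defs
  imports "HOL-Computational_Algebra.Computational_Algebra"
begin

text \<open>
  Integral domains are represented as subrings \<open>S\<close> (with the same \<open>1\<close>) of a field \<open>'k\<close>.
  The fraction field of \<open>S\<close> is then the subfield of \<open>'k\<close> generated by \<open>S\<close>, and every sum of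
  reciprocals of nonzero elements of \<open>S\<close> lies in it, so the notions below do not depend on
  the choice of the ambient field.
\<close>

definition subdomain :: "'k::field set \<Rightarrow> bool" where
  "subdomain S \<longleftrightarrow> 0 \<in> S \<and> 1 \<in> S \<and>
     (\<forall>x\<in>S. \<forall>y\<in>S. x + y \<in> S \<and> x * y \<in> S) \<and> (\<forall>x\<in>S. - x \<in> S)"

text \<open>The distinct denominators \<open>d\<^sub>1, \<dots>, d\<^sub>n\<close> with \<open>n \<ge> 1\<close> form the finite nonempty set \<open>A\<close>.\<close>

definition egyptian :: "'k::field set \<Rightarrow> 'k \<Rightarrow> bool" where
  "egyptian S x \<longleftrightarrow>
     (\<exists>A. finite A \<and> A \<noteq> {} \<and> A \<subseteq> S - {0} \<and> x = (\<Sum>d\<in>A. 1 / d))"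

definition egyptian_domain :: "'k::field set \<Rightarrow> bool" where
  "egyptian_domain S \<longleftrightarrow> subdomain S \<and> (\<forall>x\<in>S. x \<noteq> 0 \<longrightarrow> egyptian S x)"

definition multiplicative_set :: "'a::comm_ring_1 set \<Rightarrow> bool" where
  "multiplicative_set W \<longleftrightarrow> 1 \<in> W \<and> (\<forall>x\<in>W. \<forall>y\<in>W. x * y \<in> W)"

text \<open>
  The localization \<open>W\<^sup>-\<^sup>1A\<close> of an integral domain \<open>A\<close> (the type \<open>'a\<close>), as a subring of its
  fraction field. This is meaningful only for multiplicative sets with \<open>0 \<notin> W\<close>.
\<close>

definition localization :: "'a::idom set \<Rightarrow> 'a fract set" where
  "localization W = {Fract a w | a w. w \<in> W}"

lemma subdomain_range_to_fract: "subdomain (range to_fract)"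
  unfolding subdomain_def
  by (auto simp flip: to_fract_0 to_fract_1 to_fract_add to_fract_mult to_fract_uminus)

lemma subdomain_localization:
  fixes W :: "'a::idom set"
  assumes "multiplicative_set W" and "0 \<notin> W"
  shows "subdomain (localization W)"
  unfolding subdomain_def
proof (intro conjI ballI)
  have W: "1 \<in> W" "\<And>x y. x \<in> W \<Longrightarrow> y \<in> W \<Longrightarrow> x * y \<in> W"
    and nz: "\<And>w. w \<in> W \<Longrightarrow> w \<noteq> 0"
    using assms by (auto simp: multiplicative_set_def)
  show "0 \<in> localization W" "1 \<in> localization W"
    using W(1) by (auto simp: localization_def Zero_fract_def One_fract_def)
  fix x assume "x \<in> localization W"
  then obtain a v where x: "x = Fract a v" "v \<in> W"
    by (auto simp: localization_def)
  show "- x \<in> localization W"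
    using x by (auto simp: localization_def)
  fix y assume "y \<in> localization W"
  then obtain b w where y: "y = Fract b w" "w \<in> W"
    by (auto simp: localization_def)
  have "x + y = Fract (a * w + b * v) (v * w)" "x * y = Fract (a * b) (v * w)"
    using x y nz by (auto simp: add_fract)
  then show "x + y \<in> localization W" "x * y \<in> localization W"
    using x y W(2) by (auto simp: localization_def)
qed

end

theory Submission
  imports Defs
begin

text \<open>
  Write \<open>E\<close> for the set of Egyptian elements of the fraction field of a domain \<open>S\<close>. If repeated
  denominators were allowed, \<open>E\<close> would visibly be closed under sums and products. When \<open>S\<close> has a
  unit \<open>u\<close> of infinite order, repetitions do no harm: the identity
  \<open>1 / d = 1 / (d (1 + u\<^sup>k)) + 1 / (d (1 + u\<^sup>-\<^sup>k))\<close> offers infinitely many ways to split a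
  reciprocal, so one of them avoids any given finite set of denominators. Hence \<open>E\<close> is then a
  ring (\<open>subdomain_egyptian\<close>), and it contains the reciprocal of every nonzero element of \<open>S\<close>.

  For \<open>S = W\<^sup>-\<^sup>1D[X]\<close>, a nonconstant \<open>f = c\<^sub>0 + \<dots> + c\<^sub>n X\<^sup>n\<close> in \<open>W\<close> is such a unit, for degree
  reasons. The ring \<open>E\<close> contains \<open>D\<close>, because \<open>D\<close> is Egyptian, and it contains \<open>f\<close>, which is the
  reciprocal of \<open>1 / f \<in> S\<close>. In
  \<open>f / X\<^sup>n\<^sup>-\<^sup>1 = c\<^sub>n X + c\<^sub>n\<^sub>-\<^sub>1 + c\<^sub>n\<^sub>-\<^sub>2 / X + \<dots> + c\<^sub>0 / X\<^sup>n\<^sup>-\<^sup>1\<close>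
  everything except \<open>c\<^sub>n X\<close> is already known to lie in \<open>E\<close>; so \<open>c\<^sub>n X\<close> does, and \<open>X\<close> after
  multiplication by \<open>1 / c\<^sub>n\<close>. Therefore \<open>E\<close> contains \<open>D[X]\<close> and all \<open>1 / w\<close> with \<open>w \<in> W\<close>, that
  is, all of \<open>S\<close>.
\<close>

section \<open>Closure properties of subdomains\<close>

lemma
  assumes "subdomain S"
  shows subdomain_0: "0 \<in> S"
    and subdomain_1: "1 \<in> S"
    and subdomain_add: "x \<in> S \<Longrightarrow> y \<in> S \<Longrightarrow> x + y \<in> S"
    and subdomain_mult: "x \<in> S \<Longrightarrow> y \<in> S \<Longrightarrow> x * y \<in> S"
    and subdomain_uminus: "x \<in> S \<Longrightarrow> - x \<in> S"
  using assms by (auto simp: subdomain_def)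

lemma subdomain_diff:
  assumes "subdomain S" "x \<in> S" "y \<in> S"
  shows "x - y \<in> S"
  using subdomain_add[OF assms(1,2) subdomain_uminus[OF assms(1,3)]] by simp

lemma subdomain_power:
  assumes "subdomain S" "x \<in> S"
  shows "x ^ n \<in> S"
  using assms by (induction n) (auto intro: subdomain_1 subdomain_mult)

lemma subdomain_sum:
  assumes "subdomain S" "\<And>i. i \<in> I \<Longrightarrow> g i \<in> S"
  shows "sum g I \<in> S"
  using assms(2)
  by (induction I rule: infinite_finite_induct)
     (auto intro: subdomain_0[OF assms(1)] subdomain_add[OF assms(1)])

section \<open>The ring of Egyptian elements\<close>

lemma egyptian_reciprocal:
  assumes "d \<in> S" "d \<noteq> 0"
  shows "egyptian S (1 / d)"
  unfolding egyptian_def using assms by (intro exI[of _ "{d}"]) auto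

lemma egyptian_uminus:
  assumes "subdomain S" "egyptian S x"
  shows "egyptian S (- x)"
proof -
  from assms(2) obtain A where A: "finite A" "A \<noteq> {}" "A \<subseteq> S - {0}" "x = (\<Sum>d\<in>A. 1 / d)"
    by (auto simp: egyptian_def)
  have "- x = (\<Sum>d\<in>uminus ` A. 1 / d)"
    by (simp add: A(4) sum.reindex sum_negf)
  then show ?thesis
    unfolding egyptian_def using A subdomain_uminus[OF assms(1)]
    by (intro exI[of _ "uminus ` A"]) auto
qed

lemma egyptian_divide:
  assumes "subdomain S" "egyptian S x" "a \<in> S" "a \<noteq> 0"
  shows "egyptian S (x / a)"
proof -
  from assms(2) obtain A where A: "finite A" "A \<noteq> {}" "A \<subseteq> S - {0}" "x = (\<Sum>d\<in>A. 1 / d)"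
    by (auto simp: egyptian_def)
  have "inj_on ((*) a) A"
    using assms(4) by (auto simp: inj_on_def)
  then have "(\<Sum>d\<in>(*) a ` A. 1 / d) = (\<Sum>d\<in>A. 1 / (a * d))"
    by (simp add: sum.reindex)
  then have "x / a = (\<Sum>d\<in>(*) a ` A. 1 / d)"
    by (simp add: A(4) sum_divide_distrib mult.commute)
  then show ?thesis
    unfolding egyptian_def using A assms(3,4) subdomain_mult[OF assms(1)]
    by (intro exI[of _ "(*) a ` A"]) auto
qed

text \<open>
  The reciprocal \<open>1 / d\<close> is split as \<open>1 / (d (1 + v)) + 1 / (d (1 + 1 / v))\<close> with \<open>v\<close> a power of
  \<open>u\<close>. Either denominator determines \<open>v\<close>, hence the exponent, so only finitely many exponents make
  one of them vanish or collide with a denominator already present. The two denominators differ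
  because \<open>v \<noteq> \<plusminus> 1\<close>.
\<close>

lemma egyptian_add_reciprocal:
  assumes S: "subdomain S" and u: "u \<in> S" "1 / u \<in> S" "inj (\<lambda>k::nat. u ^ k)"
    and x: "egyptian S x" and d: "d \<in> S" "d \<noteq> 0"
  shows "egyptian S (x + 1 / d)"
proof -
  from x obtain A where A: "finite A" "A \<noteq> {}" "A \<subseteq> S - {0}" "x = (\<Sum>d\<in>A. 1 / d)"
    by (auto simp: egyptian_def)
  have u0: "u \<noteq> 0"
  proof
    assume "u = 0"
    then have "u ^ 1 = u ^ 2" by simp
    then show False using injD[OF u(3), of 1 2] by simp
  qed
  define p where "p k = d * (1 + u ^ k)" for k :: nat
  define q where "q k = d * (1 + (1 / u) ^ k)" for k :: nat
  have "inj p" "inj q"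
    using u(3) d(2) u0 by (auto simp: inj_def p_def q_def power_one_over)
  then have "finite (insert 0 (p -` insert 0 A \<union> q -` insert 0 A))"
    using A(1) by (auto intro!: finite_vimageI)
  then obtain k where "k \<notin> insert 0 (p -` insert 0 A \<union> q -` insert 0 A)"
    using ex_new_if_finite[OF infinite_UNIV_nat] by blast
  then have k: "k \<noteq> 0" "p k \<noteq> 0" "q k \<noteq> 0" "p k \<notin> A" "q k \<notin> A"
    by auto
  define v where "v = u ^ k"
  have v0: "v \<noteq> 0" and v1: "1 + v \<noteq> 0"
    using u0 k(2) by (auto simp: v_def p_def)
  have pv: "p k = d * (1 + v)" and qv: "q k = d * (1 + v) / v"
    using v0 by (auto simp: p_def q_def v_def power_one_over field_simps)
  have "p k \<noteq> q k"
  proof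
    assume "p k = q k"
    then have "v * v = 1"
      using v0 v1 d(2) by (auto simp: pv qv field_simps)
    moreover have "v \<noteq> - 1"
      using v1 by auto
    ultimately have "v = 1"
      by (simp add: square_eq_1_iff)
    then show False
      using injD[OF u(3), of k 0] k(1) by (simp add: v_def)
  qed
  moreover have "1 / p k + 1 / q k = 1 / d"
    using v0 v1 d(2) by (simp add: pv qv divide_simps)
  ultimately have "x + 1 / d = (\<Sum>d\<in>insert (p k) (insert (q k) A). 1 / d)"
    using A(1,4) k(4,5) by (simp add: algebra_simps)
  moreover have "p k \<in> S" "q k \<in> S"
    unfolding p_def q_def
    by (intro subdomain_mult[OF S] subdomain_add[OF S] subdomain_power[OF S]
        subdomain_1[OF S] d(1) u(1,2))+
  ultimately show ?thesis
    unfolding egyptian_def using A k(2,3)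
    by (intro exI[of _ "insert (p k) (insert (q k) A)"]) auto
qed

lemma egyptian_add_sum_reciprocals:
  assumes S: "subdomain S" and u: "u \<in> S" "1 / u \<in> S" "inj (\<lambda>k::nat. u ^ k)"
    and x: "egyptian S x" and A: "finite A" "A \<subseteq> S - {0}"
  shows "egyptian S (x + (\<Sum>d\<in>A. 1 / d))"
  using A
proof (induction A)
  case empty
  then show ?case using x by simp
next
  case (insert d A)
  then have "egyptian S (x + (\<Sum>d\<in>A. 1 / d) + 1 / d)"
    by (intro egyptian_add_reciprocal[OF S u]) auto
  then show ?case
    using insert.hyps by (simp add: algebra_simps)
qed

lemma egyptian_add:
  assumes "subdomain S" "u \<in> S" "1 / u \<in> S" "inj (\<lambda>k::nat. u ^ k)"
    and "egyptian S x" "egyptian S y"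
  shows "egyptian S (x + y)"
  using assms(6) egyptian_add_sum_reciprocals[OF assms(1-5)]
  by (auto simp: egyptian_def[of S y])

text \<open>
  A product distributes over the representation of one factor, which leaves a sum of Egyptian
  elements. The empty sum is not an Egyptian representation of \<open>0\<close>; adding the Egyptian elements
  \<open>1\<close> and \<open>- 1\<close> gives one, even in characteristic \<open>2\<close>.
\<close>

lemma subdomain_egyptian:
  assumes S: "subdomain S" and u: "u \<in> S" "1 / u \<in> S" "inj (\<lambda>k::nat. u ^ k)"
  shows "subdomain {x. egyptian S x}"
proof -
  note add = egyptian_add[OF S u]
  have one: "egyptian S 1"
    using egyptian_reciprocal[OF subdomain_1[OF S]] by simp
  have zero: "egyptian S 0"
    using add[OF one egyptian_uminus[OF S one]] by simp
  have "egyptian S (x * y)" if x: "egyptian S x" and y: "egyptian S y" for x y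
  proof -
    from y obtain B where B: "finite B" "B \<subseteq> S - {0}" "y = (\<Sum>d\<in>B. 1 / d)"
      by (auto simp: egyptian_def)
    have "egyptian S (\<Sum>d\<in>B. x / d)"
      using B(1,2)
      by (induction B) (auto intro: zero add egyptian_divide[OF S x])
    then show ?thesis
      by (simp add: B(3) sum_distrib_left)
  qed
  then show ?thesis
    unfolding subdomain_def using zero one add egyptian_uminus[OF S] by auto
qed

section \<open>Transfer of Egyptian representations along embeddings\<close>

lemma prod_times_sum_reciprocals:
  fixes h :: "'a::comm_ring_1 \<Rightarrow> 'k::field"
  assumes "h 0 = 0" "\<And>x y. h (x + y) = h x + h y" "\<And>x y. h (x * y) = h x * h y"
    and B: "finite B" "\<And>b. b \<in> B \<Longrightarrow> h b \<noteq> 0"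
  shows "h (\<Prod>B) * (\<Sum>b\<in>B. 1 / h b) = h (\<Sum>b\<in>B. \<Prod>(B - {b}))"
proof -
  have "h (sum g C) = (\<Sum>b\<in>C. h (g b))" for g :: "'a \<Rightarrow> 'a" and C
    by (induction C rule: infinite_finite_induct) (auto simp: assms)
  moreover have "h (\<Prod>B) * (1 / h b) = h (\<Prod>(B - {b}))" if "b \<in> B" for b
  proof -
    have "\<Prod>B = b * \<Prod>(B - {b})"
      using B(1) that by (rule prod.remove)
    then show ?thesis
      using B(2)[OF that] by (simp add: assms(3))
  qed
  ultimately show ?thesis
    by (simp add: sum_distrib_left)
qed

text \<open>
  An Egyptian representation amounts to an equation in the domain itself, obtained by clearing
  denominators; such an equation is preserved by every embedding.
\<close>

lemma embedding_eq_sum_reciprocals: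
  fixes h :: "'a::idom \<Rightarrow> 'k::field"
  assumes "h 0 = 0" "\<And>x y. h (x + y) = h x + h y" "\<And>x y. h (x * y) = h x * h y"
    and inj: "\<And>x. h x = 0 \<Longrightarrow> x = 0"
    and B: "finite B" "0 \<notin> B" and c: "to_fract c = (\<Sum>b\<in>B. 1 / to_fract b)"
  shows "h c = (\<Sum>b\<in>B. 1 / h b)"
proof -
  have "to_fract (\<Prod>B * c) = to_fract (\<Sum>b\<in>B. \<Prod>(B - {b}))"
    using prod_times_sum_reciprocals[of to_fract B] B by (auto simp: c)
  then have "\<Prod>B * c = (\<Sum>b\<in>B. \<Prod>(B - {b}))"
    by (simp only: to_fract_eq_iff)
  then have "h (\<Prod>B) * h c = h (\<Prod>B) * (\<Sum>b\<in>B. 1 / h b)"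
    using prod_times_sum_reciprocals[of h B] assms by metis
  moreover have "h (\<Prod>B) \<noteq> 0"
    using inj B by (metis prod_zero_iff)
  ultimately show ?thesis
    by simp
qed

lemma egyptian_embedding:
  fixes h :: "'a::idom \<Rightarrow> 'k::field"
  assumes "h 0 = 0" "\<And>x y. h (x + y) = h x + h y" "\<And>x y. h (x * y) = h x * h y"
    and inj: "\<And>x. h x = 0 \<Longrightarrow> x = 0"
    and S: "range h \<subseteq> S"
    and c: "egyptian (range to_fract) (to_fract c)"
  shows "egyptian S (h c)"
proof -
  from c obtain A where A: "finite A" "A \<noteq> {}" "A \<subseteq> range to_fract - {0}"
      "to_fract c = (\<Sum>d\<in>A. 1 / d)"
    by (auto simp: egyptian_def)
  define B where "B = {b. to_fract b \<in> A}"
  have A_eq: "A = to_fract ` B"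
    using A(3) by (auto simp: B_def)
  have inj_to_fract: "inj_on to_fract B"
    by (auto simp: inj_on_def)
  have B: "finite B" "B \<noteq> {}" "0 \<notin> B"
    using A finite_image_iff[OF inj_to_fract] by (auto simp: A_eq)
  have sum_B: "to_fract c = (\<Sum>b\<in>B. 1 / to_fract b)"
    unfolding A(4) A_eq by (simp add: sum.reindex[OF inj_to_fract])
  have hc: "h c = (\<Sum>b\<in>B. 1 / h b)"
    by (rule embedding_eq_sum_reciprocals[where h = h, OF _ _ _ _ B(1,3) sum_B]) (fact assms)+
  have "inj_on h B"
  proof (rule inj_onI)
    fix x y assume "h x = h y"
    moreover have "h x = h (x - y) + h y"
      by (simp flip: assms(2))
    ultimately show "x = y"
      using inj[of "x - y"] by simp
  qed
  then have "h c = (\<Sum>d\<in>h ` B. 1 / d)"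
    by (simp add: hc sum.reindex)
  moreover have "0 \<notin> h ` B"
    using inj B(3) by force
  ultimately show ?thesis
    unfolding egyptian_def using B(1,2) S by (intro exI[of _ "h ` B"]) auto
qed

section \<open>Rings generated by the constants and the variable\<close>

lemma to_fract_poly_eq_sum:
  fixes p :: "'a::idom poly"
  shows "to_fract p = (\<Sum>i\<le>degree p. to_fract [:coeff p i:] * to_fract [:0, 1:] ^ i)"
proof -
  have to_fract_sum: "to_fract (sum g I) = (\<Sum>i\<in>I. to_fract (g i))"
    for g :: "nat \<Rightarrow> 'a poly" and I
    by (induction I rule: infinite_finite_induct) auto
  have to_fract_power: "to_fract (q ^ i) = to_fract q ^ i" for q :: "'a poly" and i
    by (induction i) auto
  have "p = (\<Sum>i\<le>degree p. [:coeff p i:] * [:0, 1:] ^ i)"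
    by (subst poly_as_sum_of_monoms[of p, symmetric])
       (simp add: monom_altdef)
  then have "to_fract p = to_fract (\<Sum>i\<le>degree p. [:coeff p i:] * [:0, 1:] ^ i)"
    by (rule arg_cong)
  then show ?thesis
    by (simp only: to_fract_sum to_fract_mult to_fract_power)
qed

text \<open>
  Division of \<open>f\<close> by \<open>X\<^sup>n\<^sup>-\<^sup>1\<close>, with \<open>n\<close> the degree of \<open>f\<close>, leaves the leading coefficient times
  \<open>X\<close> as the only term with a positive power of \<open>X\<close>.
\<close>

lemma variable_in_subdomain:
  fixes f :: "'a::idom poly" and E :: "'a poly fract set"
  assumes E: "subdomain E" and const: "\<And>c. to_fract [:c:] \<in> E"
    and inv: "\<And>g. g \<noteq> 0 \<Longrightarrow> 1 / to_fract g \<in> E"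
    and f: "to_fract f \<in> E" "degree f > 0"
  shows "to_fract [:0, 1:] \<in> E"
proof -
  let ?X = "to_fract [:0, 1:] :: 'a poly fract" and ?C = "\<lambda>c::'a. to_fract [:c:]"
  obtain m where m: "degree f = Suc m"
    using f(2) gr0_conv_Suc by auto
  have X: "1 / ?X \<in> E" and X0: "?X \<noteq> 0"
    using inv[of "[:0, 1:]"] by auto
  let ?t = "\<Sum>i\<le>m. ?C (coeff f i) * (1 / ?X) ^ (m - i)"
  have split: "?X ^ i = (1 / ?X) ^ (m - i) * ?X ^ m" if "i \<le> m" for i
    using X0 that by (simp add: power_one_over field_simps flip: power_add)
  have "to_fract f = (\<Sum>i\<le>m. ?C (coeff f i) * ?X ^ i) + ?C (lead_coeff f) * ?X ^ Suc m"
    by (subst to_fract_poly_eq_sum) (simp add: m)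
  also have "(\<Sum>i\<le>m. ?C (coeff f i) * ?X ^ i) = ?t * ?X ^ m"
    unfolding sum_distrib_right
  proof (rule sum.cong[OF refl])
    fix i assume "i \<in> {..m}"
    then have "?X ^ i = (1 / ?X) ^ (m - i) * ?X ^ m"
      by (intro split) simp
    then show "?C (coeff f i) * ?X ^ i = ?C (coeff f i) * (1 / ?X) ^ (m - i) * ?X ^ m"
      by (simp only: mult.assoc)
  qed
  finally have "to_fract f * (1 / ?X) ^ m - ?t = ?C (lead_coeff f) * ?X"
    using X0 by (simp add: power_one_over field_simps)
  moreover have "to_fract f * (1 / ?X) ^ m - ?t \<in> E"
    by (intro subdomain_diff[OF E] subdomain_mult[OF E] subdomain_sum[OF E]
        subdomain_power[OF E] f(1) X const)
  ultimately have "?C (lead_coeff f) * ?X \<in> E"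
    by simp
  moreover have "[:lead_coeff f:] \<noteq> 0"
    using f(2) by auto
  ultimately show ?thesis
    using subdomain_mult[OF E inv[of "[:lead_coeff f:]"]] by force
qed

section \<open>Localizations of the polynomial ring\<close>

theorem proposition2p1:
  fixes W :: "'a::idom poly set"
  assumes "egyptian_domain (range (to_fract :: 'a \<Rightarrow> 'a fract))"
    and "multiplicative_set W"
    and "0 \<notin> W"
    and "\<not> W \<subseteq> range (\<lambda>c. [:c:])"
  shows "egyptian_domain (localization W)"
proof -
  let ?R = "localization W"
  have R: "subdomain ?R"
    using assms(2,3) by (rule subdomain_localization)
  have poly_R: "to_fract g \<in> ?R" for g
    using assms(2) by (auto simp: localization_def multiplicative_set_def to_fract_def)
  obtain f where f: "f \<in> W" "degree f > 0"
    using assms(4) by (metis degree_eq_zeroE gr0I rangeI subsetI)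
  then have f0: "f \<noteq> 0" by auto
  have inv_f: "1 / to_fract f \<in> ?R"
  proof -
    have "1 / to_fract f = Fract 1 f"
      by (simp add: to_fract_def One_fract_def)
    then show ?thesis
      using f(1) by (auto simp: localization_def)
  qed
  have inj: "inj (\<lambda>k::nat. to_fract f ^ k)"
  proof (rule injI)
    fix k l :: nat
    have to_fract_power: "to_fract (f ^ i) = to_fract f ^ i" for i
      by (induction i) auto
    assume "to_fract f ^ k = to_fract f ^ l"
    then have "f ^ k = f ^ l"
      by (simp flip: to_fract_power)
    then have "k * degree f = l * degree f"
      using degree_power_eq[OF f0, of k] degree_power_eq[OF f0, of l] by auto
    then show "k = l"
      using f(2) by simp
  qed
  define E where "E = {x. egyptian ?R x}"
  have E: "subdomain E"
    unfolding E_def by (rule subdomain_egyptian[OF R poly_R inv_f inj])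
  have inv: "1 / to_fract g \<in> E" if "g \<noteq> 0" for g
    using egyptian_reciprocal[OF poly_R] that by (simp add: E_def)
  have const: "to_fract [:c:] \<in> E" for c
  proof (cases "c = 0")
    case True
    then show ?thesis using subdomain_0[OF E] by simp
  next
    case False
    then have "egyptian (range to_fract) (to_fract c)"
      using assms(1) by (auto simp: egyptian_domain_def)
    then have "egyptian ?R (to_fract [:c:])"
      using poly_R
      by (intro egyptian_embedding[where h = "\<lambda>c. to_fract [:c:]"])
         (auto simp flip: to_fract_add to_fract_mult)
    then show ?thesis by (simp add: E_def)
  qed
  have "egyptian ?R (1 / (1 / to_fract f))"
    using f0 by (intro egyptian_reciprocal[OF inv_f]) auto
  then have "to_fract f \<in> E"
    by (simp add: E_def)
  then have X: "to_fract [:0, 1:] \<in> E"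
    using variable_in_subdomain[OF E const inv] f(2) by blast
  have poly_E: "to_fract g \<in> E" for g
    by (subst to_fract_poly_eq_sum)
       (intro subdomain_sum[OF E] subdomain_mult[OF E] subdomain_power[OF E] const X)
  have "egyptian ?R x" if x: "x \<in> ?R" for x
  proof -
    obtain a w where aw: "x = Fract a w" "w \<in> W"
      using x by (auto simp: localization_def)
    then have "w \<noteq> 0" using assms(3) by auto
    then have "to_fract a * (1 / to_fract w) \<in> E"
      by (intro subdomain_mult[OF E] poly_E inv)
    then show ?thesis
      by (simp add: aw(1) E_def to_fract_def)
  qed
  then show ?thesis
    using R by (simp add: egyptian_domain_def)
qed

end
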